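(* Let $G\in\mathbb{C}^{\mathcal I\times\mathcal I}$, let $Q=(Q_{tc})_{t\in\mathcal{T}_{\mathcal I},c\in\mathcal{D}_t}$ be an orthogonal directional cluster basis with transfer matrices $E_{t'c}$, and let $(\epsilon_t)_{t\in\mathcal{T}_{\mathcal I}}$ be a family of positive real numbers. Let the matrices $G_{tc}$, $\widehat G_{tc}$, $\widehat Q_{tc}$ be defined as in the context. If $$\|G_{tc}-Q_{tc}Q_{tc}^*G_{tc}\|\le\epsilon_t$$ holds for all leaf clusters $t$ and all $c\in\mathcal{D}_t$, and $$\|\widehat G_{tc}-\widehat Q_{tc}\widehat Q_{tc}^*\widehat G_{tc}\|\le\epsilon_t$$ holds for all non-leaf clusters $t$ and all $c\in\mathcal{D}_t$, then $$\|G_{tc}-Q_{tc}Q_{tc}^*G_{tc}\|^2\le\sum_{r\in\operatorname{desc}(t)}\epsilon_r^2\qquad\text{for all } t\in\mathcal{T}_{\mathcal I},\ c\in\mathcal{D}_t.$$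
   Context: $\mathcal I$ is a finite index set. A cluster tree $\mathcal{T}_{\mathcal I}$ is a finite rooted tree whose nodes $t$ (clusters) carry labels $\hat t\subseteq\mathcal I$ such that the root has label $\mathcal I$, distinct sons of the same node have disjoint labels, and $\hat t=\bigcup_{t'\in\operatorname{sons}(t)}\hat t'$ if $\operatorname{sons}(t)\ne\emptyset$. Every non-leaf cluster $t$ has exactly two sons, $\operatorname{sons}(t)=\{t_1,t_2\}$, $t_1\neq t_2$. $\operatorname{level}(t)$ is the distance of $t$ from the root, and $\operatorname{desc}(t)$ is the set of descendants of $t$, including $t$ itself. A block tree $\mathcal{T}_{\mathcal I\times\mathcal I}$ is a tree whose nodes (blocks) are pairs $b=(t,s)$ of clusters, labeled $\hat t\times\hat s$, whose root is the pair (root, root), and in which every block $b=(t,s)$ with sons satisfies $\operatorname{sons}(b)=\operatorname{sons}(t)\times\operatorname{sons}(s)$. A subset $\mathcal{L}^+$ of its leaves, called admissible leaves, is fixed. Directions: for each level $\ell$, $\mathcal{D}_\ell\subseteq\mathbb{R}^3$ is a finite set whose elements are unit vectors or $0$, and $\operatorname{sd}_\ell:\mathcal{D}_\ell\to\mathcal{D}_{\ell+1}$ satisfies $\|c-\operatorname{sd}_\ell(c)\|\le\|c-\tilde c\|$ for all $c\in\mathcal{D}_\ell,\tilde c\in\mathcal{D}_{\ell+1}$. Write $\mathcal{D}_t:=\mathcal{D}_{\operatorname{level}(t)}$, $\operatorname{sd}_t:=\operatorname{sd}_{\operatorname{level}(t)}$. Each $b=(t,s)\in\mathcal{L}^+$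 is assigned a block direction $c_b\in\mathcal{D}_t=\mathcal{D}_s$. A directional cluster basis of rank $k$ is a family $Q=(Q_{tc})$, $Q_{tc}\in\mathbb{C}^{\hat t\times k}$, with transfer matrices $E_{t'c}\in\mathbb{C}^{k\times k}$ such that $Q_{tc}|_{\hat t'\times k}=Q_{t'c'}E_{t'c}$, $c'=\operatorname{sd}_t(c)$, for all $t\in\mathcal{T}_{\mathcal I}$, $t'\in\operatorname{sons}(t)$, $c\in\mathcal{D}_t$. It is orthogonal if $Q_{tc}^*Q_{tc}=I$ for all $t,c$. For $t\in\mathcal{T}_{\mathcal I}$ and $c\in\mathcal{D}_t$, let $F_{tc}$ be the set of clusters $s$ for which there is a cluster $t^+$ with $t\in\operatorname{desc}(t^+)$, $b=(t^+,s)\in\mathcal{L}^+$, and such that $c$ is obtained from $c_b$ by successively applying the son mappings from $\operatorname{level}(t^+)$ down to $\operatorname{level}(t)$, i.e. $c=\operatorname{sd}_{\operatorname{level}(t)-1}\circ\cdots\circ\operatorname{sd}_{\operatorname{level}(t^+)}(c_b)$ (with $c=c_b$ if $t^+=t$). Let $\mathcal{F}_{tc}:=\bigcup\{\hat s:s\in F_{tc}\}$ and $G_{tc}:=G|_{\hat t\times\mathcal{F}_{tc}}$. For non-leaf $t$ with sons $t_1,t_2$, $c\in\mathcal{D}_t$ and $c':=\operatorname{sd}_t(c)$, let $$\widehat Q_{tc}:=\begin{pmatrix} E_{t_1c} \\ E_{t_2c} \end{pmatrix},\qquad \widehat G_{tc}:=\begin{pmatrix} Q_{t_1c'}^*G|_{\hat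 t_1\times\mathcal{F}_{tc}} \\ Q_{t_2c'}^*G|_{\hat t_2\times\mathcal{F}_{tc}} \end{pmatrix}.$$ $\|\cdot\|$ applied to matrices denotes either the spectral norm or the Frobenius norm (the same one throughout). *)

theory Defs
  imports "HOL-Analysis.Analysis"
begin

record 'v tree =
  nodes :: "'v set"
  tree_root :: 'v
  sons :: "'v \<Rightarrow> 'v set"

definition edges :: "('v, 'm) tree_scheme \<Rightarrow> ('v \<times> 'v) set" where
  "edges T = {(u, v). u \<in> nodes T \<and> v \<in> sons T u}"

definition rooted_tree :: "('v, 'm) tree_scheme \<Rightarrow> bool" where
  "rooted_tree T \<longleftrightarrow>
     finite (nodes T) \<and> tree_root T \<in> nodes T \<and>
     (\<forall>t\<in>nodes T. sons T t \<subseteq> nodes T - {tree_root T}) \<and>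
     (\<forall>t\<in>nodes T. \<forall>u\<in>nodes T. t \<noteq> u \<longrightarrow> sons T t \<inter> sons T u = {}) \<and>
     (\<forall>t\<in>nodes T. (tree_root T, t) \<in> (edges T)\<^sup>*)"

definition level :: "('v, 'm) tree_scheme \<Rightarrow> 'v \<Rightarrow> nat" where
  "level T t = (LEAST n. (tree_root T, t) \<in> edges T ^^ n)"

definition desc :: "('v, 'm) tree_scheme \<Rightarrow> 'v \<Rightarrow> 'v set" where
  "desc T t = {r. (t, r) \<in> (edges T)\<^sup>*}"

definition leaves :: "('v, 'm) tree_scheme \<Rightarrow> 'v set" where
  "leaves T = {t \<in> nodes T. sons T t = {}}"

definition levels :: "('v, 'm) tree_scheme \<Rightarrow> nat set" where
  "levels T = level T ` nodes T"

text \<open>The index set is the finite type \<open>'i\<close>. Clusters are nodes, not index sets: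
  different clusters may carry the same label.\<close>

record ('v, 'i) cluster_tree = "'v tree" +
  label :: "'v \<Rightarrow> 'i set"

definition is_cluster_tree :: "('v, 'i::finite) cluster_tree \<Rightarrow> bool" where
  "is_cluster_tree T \<longleftrightarrow>
     rooted_tree T \<and> label T (tree_root T) = UNIV \<and>
     (\<forall>t\<in>nodes T. disjoint_family_on (label T) (sons T t)) \<and>
     (\<forall>t\<in>nodes T - leaves T. label T t = (\<Union>t'\<in>sons T t. label T t'))"

text \<open>The pair \<open>(son1, son2)\<close> enumerates the two sons of every non-leaf cluster.\<close>

definition binary_sons ::
    "('v, 'i::finite) cluster_tree \<Rightarrow> ('v \<Rightarrow> 'v) \<Rightarrow> ('v \<Rightarrow> 'v) \<Rightarrow> bool" where
  "binary_sons T son1 son2 \<longleftrightarrow>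
     (\<forall>t\<in>nodes T - leaves T. sons T t = {son1 t, son2 t} \<and> son1 t \<noteq> son2 t)"

definition is_block_tree ::
    "('v, 'i::finite) cluster_tree \<Rightarrow> ('v \<times> 'v) tree \<Rightarrow> bool" where
  "is_block_tree T B \<longleftrightarrow>
     rooted_tree B \<and> nodes B \<subseteq> nodes T \<times> nodes T \<and>
     tree_root B = (tree_root T, tree_root T) \<and>
     (\<forall>(t, s)\<in>nodes B - leaves B. sons B (t, s) = sons T t \<times> sons T s)"

type_synonym direction = "real^3"

definition directions ::
    "('v, 'i::finite) cluster_tree \<Rightarrow> (nat \<Rightarrow> direction set) \<Rightarrow> bool" where
  "directions T D \<longleftrightarrow>
     (\<forall>l\<in>levels T. finite (D l) \<and> (\<forall>c\<in>D l. norm c = 1 \<or> c = 0))"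

definition son_directions ::
    "('v, 'i::finite) cluster_tree \<Rightarrow> (nat \<Rightarrow> direction set)
      \<Rightarrow> (nat \<Rightarrow> direction \<Rightarrow> direction) \<Rightarrow> bool" where
  "son_directions T D sd \<longleftrightarrow>
     (\<forall>l. l \<in> levels T \<longrightarrow> Suc l \<in> levels T \<longrightarrow>
       (\<forall>c\<in>D l. sd l c \<in> D (Suc l) \<and>
         (\<forall>c'\<in>D (Suc l). norm (c - sd l c) \<le> norm (c - c'))))"

text \<open>\<open>sd_iter sd l n\<close> is the composition of the \<open>n\<close> son mappings
  of the levels \<open>l, \<dots>, l + n - 1\<close>.\<close>

primrec sd_iter ::
    "(nat \<Rightarrow> direction \<Rightarrow> direction) \<Rightarrow> nat \<Rightarrow> nat \<Rightarrow> direction \<Rightarrow> direction" where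
  "sd_iter sd l 0 c = c"
| "sd_iter sd l (Suc n) c = sd (l + n) (sd_iter sd l n c)"

text \<open>A matrix with rows in a subset \<open>R\<close> and columns in a subset \<open>C\<close> of the index types is
  represented by its extension by zero. Sums, products, adjoints, and both the spectral and the
  Frobenius norm of matrices are compatible with this extension.\<close>

definition restrict_mat :: "'m set \<Rightarrow> 'n set \<Rightarrow> complex^'n::finite^'m::finite \<Rightarrow> complex^'n^'m" where
  "restrict_mat R C A = (\<chi> i j. if i \<in> R \<and> j \<in> C then A $ i $ j else 0)"

definition ctranspose :: "complex^'n::finite^'m::finite \<Rightarrow> complex^'m^'n" where
  "ctranspose A = map_matrix cnj (transpose A)"

definition vstack ::
    "complex^'n::finite^'a::finite \<Rightarrow> complex^'n^'b::finite \<Rightarrow> complex^'n^('a + 'b)" where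
  "vstack A B = (\<chi> i. case i of Inl a \<Rightarrow> A $ a | Inr b \<Rightarrow> B $ b)"

text \<open>The norm of the type \<open>complex^'n^'m\<close> is the Euclidean norm of all entries, i.e. the
  Frobenius norm.\<close>

datatype norm_kind = Spectral | Frobenius

fun mat_norm :: "norm_kind \<Rightarrow> complex^'n::finite^'m::finite \<Rightarrow> real" where
  "mat_norm Spectral A = onorm (\<lambda>x. A *v x)"
| "mat_norm Frobenius A = norm A"

text \<open>The rank is \<open>CARD('k)\<close>.\<close>

definition directional_cluster_basis ::
    "('v, 'i::finite) cluster_tree \<Rightarrow> (nat \<Rightarrow> direction set) \<Rightarrow> (nat \<Rightarrow> direction \<Rightarrow> direction)
      \<Rightarrow> ('v \<Rightarrow> direction \<Rightarrow> complex^'k::finite^'i) \<Rightarrow> ('v \<Rightarrow> direction \<Rightarrow> complex^'k^'k) \<Rightarrow> bool" where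
  "directional_cluster_basis T D sd Q E \<longleftrightarrow>
     (\<forall>t\<in>nodes T. \<forall>c\<in>D (level T t). \<forall>i. i \<notin> label T t \<longrightarrow> Q t c $ i = 0) \<and>
     (\<forall>t\<in>nodes T. \<forall>t'\<in>sons T t. \<forall>c\<in>D (level T t).
        restrict_mat (label T t') UNIV (Q t c) = Q t' (sd (level T t) c) ** E t' c)"

definition orthogonal_basis ::
    "('v, 'i::finite) cluster_tree \<Rightarrow> (nat \<Rightarrow> direction set)
      \<Rightarrow> ('v \<Rightarrow> direction \<Rightarrow> complex^'k::finite^'i) \<Rightarrow> bool" where
  "orthogonal_basis T D Q \<longleftrightarrow>
     (\<forall>t\<in>nodes T. \<forall>c\<in>D (level T t). ctranspose (Q t c) ** Q t c = mat 1)"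

definition far_clusters ::
    "('v, 'i::finite) cluster_tree \<Rightarrow> (nat \<Rightarrow> direction \<Rightarrow> direction) \<Rightarrow> ('v \<times> 'v) set
      \<Rightarrow> ('v \<times> 'v \<Rightarrow> direction) \<Rightarrow> 'v \<Rightarrow> direction \<Rightarrow> 'v set" where
  "far_clusters T sd Ladm bdir t c =
     {s. \<exists>tp. t \<in> desc T tp \<and> (tp, s) \<in> Ladm \<and>
        c = sd_iter sd (level T tp) (level T t - level T tp) (bdir (tp, s))}"

definition far_indices ::
    "('v, 'i::finite) cluster_tree \<Rightarrow> (nat \<Rightarrow> direction \<Rightarrow> direction) \<Rightarrow> ('v \<times> 'v) set
      \<Rightarrow> ('v \<times> 'v \<Rightarrow> direction) \<Rightarrow> 'v \<Rightarrow> direction \<Rightarrow> 'i set" where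
  "far_indices T sd Ladm bdir t c = (\<Union>s\<in>far_clusters T sd Ladm bdir t c. label T s)"

definition G_far ::
    "('v, 'i::finite) cluster_tree \<Rightarrow> (nat \<Rightarrow> direction \<Rightarrow> direction) \<Rightarrow> ('v \<times> 'v) set
      \<Rightarrow> ('v \<times> 'v \<Rightarrow> direction) \<Rightarrow> complex^'i^'i \<Rightarrow> 'v \<Rightarrow> direction \<Rightarrow> complex^'i^'i" where
  "G_far T sd Ladm bdir G t c = restrict_mat (label T t) (far_indices T sd Ladm bdir t c) G"

definition Q_hat ::
    "('v \<Rightarrow> 'v) \<Rightarrow> ('v \<Rightarrow> 'v) \<Rightarrow> ('v \<Rightarrow> direction \<Rightarrow> complex^'k::finite^'k)
      \<Rightarrow> 'v \<Rightarrow> direction \<Rightarrow> complex^'k^('k + 'k)" where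
  "Q_hat son1 son2 E t c = vstack (E (son1 t) c) (E (son2 t) c)"

definition G_hat ::
    "('v, 'i::finite) cluster_tree \<Rightarrow> ('v \<Rightarrow> 'v) \<Rightarrow> ('v \<Rightarrow> 'v) \<Rightarrow> (nat \<Rightarrow> direction \<Rightarrow> direction)
      \<Rightarrow> ('v \<times> 'v) set \<Rightarrow> ('v \<times> 'v \<Rightarrow> direction) \<Rightarrow> ('v \<Rightarrow> direction \<Rightarrow> complex^'k::finite^'i)
      \<Rightarrow> complex^'i^'i \<Rightarrow> 'v \<Rightarrow> direction \<Rightarrow> complex^'i^('k + 'k)" where
  "G_hat T son1 son2 sd Ladm bdir Q G t c =
     (let c' = sd (level T t) c; F = far_indices T sd Ladm bdir t c in
      vstack (ctranspose (Q (son1 t) c') ** restrict_mat (label T (son1 t)) F G)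
             (ctranspose (Q (son2 t) c') ** restrict_mat (label T (son2 t)) F G))"

end

theory Submission
  imports Defs
begin

text \<open>Let \<open>t\<close> be a cluster with sons \<open>t1\<close>, \<open>t2\<close>, write \<open>P\<close> for its far-field block and \<open>Q1\<close>, \<open>Q2\<close> for
  the bases of the sons at \<open>c' = sd c\<close>. The columns of each are orthonormal and the sons have disjoint
  labels, so \<open>U = (Q1 Q2)\<close> has
  orthonormal columns. The transfer relation says \<open>Q = U Qhat\<close>, and \<open>Ghat = U\<^sup>* P\<close>. Hence
  \<open>P - Q Q\<^sup>* P = (P - U U\<^sup>* P) + U (Ghat - Qhat Qhat\<^sup>* Ghat)\<close>.
  The range of the first term is orthogonal to the range of \<open>U\<close>, and \<open>U\<close> preserves norms, so
  the square of the error at \<open>t\<close> is at most \<open>\<parallel>P - U U\<^sup>* P\<parallel>\<^sup>2\<close> plus the square of the local error,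
  which is bounded by \<open>(\<epsilon> t)\<^sup>2\<close> (\<open>projection_error_mult\<close>).

  The first term consists of the projection errors of the two row blocks of \<open>P\<close>, and these have
  disjoint rows, so their squares add up again (\<open>projection_error_hstack\<close>). The far field of
  \<open>(t, c)\<close> is contained in that of each \<open>(ti, c')\<close> (\<open>far_indices_son\<close>). Each of the two errors
  therefore consists of columns of the error at \<open>(ti, c')\<close> and is no larger
  (\<open>projection_error_restrict_columns\<close>, \<open>mat_norm_restrict_columns_le\<close>). Induction over the
  tree gives the sum over all descendants, because the
  descendants of \<open>t\<close> are \<open>t\<close> and, disjointly, those of \<open>t1\<close> and of \<open>t2\<close>.

  Both norms enter only through Pythagoras, isometry and monotonicity under restriction to
  columns. The squares add up with equality for the Frobenius norm; for the spectral norm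
  only the inequality holds, and it suffices.\<close>

section \<open>Level and descendants in a rooted tree\<close>

text \<open>The root is not a son and parents are unique, so every path from the root to \<open>v\<close> ends with
  the edge from \<open>u\<close>.\<close>

lemma son_edge:
  assumes "rooted_tree T" "(u, v) \<in> edges T"
  shows son_edge_in_nodes: "v \<in> nodes T" and level_son: "level T v = Suc (level T u)"
proof -
  have u: "u \<in> nodes T" and vs: "v \<in> sons T u"
    using assms(2) by (auto simp: edges_def)
  show "v \<in> nodes T"
    using assms(1) u vs by (auto simp: rooted_tree_def)
  have "v \<noteq> tree_root T"
    using assms(1) u vs by (auto simp: rooted_tree_def)
  have parent: "w = u" if "(w, v) \<in> edges T" for w
    using that assms(1) u vs unfolding rooted_tree_def edges_def by blast
  have "(tree_root T, u) \<in> (edges T)\<^sup>*"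
    using assms(1) u by (auto simp: rooted_tree_def)
  then obtain n where "(tree_root T, u) \<in> edges T ^^ n"
    by (meson rtrancl_imp_relpow)
  then have "(tree_root T, u) \<in> edges T ^^ level T u"
    unfolding level_def by (rule LeastI)
  then have path: "(tree_root T, v) \<in> edges T ^^ Suc (level T u)"
    using assms(2) by auto
  have "Suc (level T u) \<le> m" if m: "(tree_root T, v) \<in> edges T ^^ m" for m
  proof (cases m)
    case 0
    then show ?thesis using m \<open>v \<noteq> tree_root T\<close> by simp
  next
    case (Suc m')
    then obtain w where "(tree_root T, w) \<in> edges T ^^ m'" "(w, v) \<in> edges T"
      using m by auto
    with parent have "(tree_root T, u) \<in> edges T ^^ m'" by blast
    then have "level T u \<le> m'"
      unfolding level_def by (rule Least_le)
    then show ?thesis using Suc by simp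
  qed
  with path show "level T v = Suc (level T u)"
    unfolding level_def[of T v] by (intro Least_equality)
qed

lemma level_desc:
  assumes "rooted_tree T" "r \<in> desc T t"
  shows "r = t \<or> level T t < level T r"
proof -
  have "(t, r) \<in> (edges T)\<^sup>*" using assms(2) by (simp add: desc_def)
  then show ?thesis
    by (induction rule: rtrancl_induct) (auto simp: level_son[OF assms(1)])
qed

lemma desc_subset_nodes:
  assumes "rooted_tree T" "t \<in> nodes T"
  shows "desc T t \<subseteq> nodes T"
proof
  fix r assume "r \<in> desc T t"
  then have "(t, r) \<in> (edges T)\<^sup>*" by (simp add: desc_def)
  then show "r \<in> nodes T"
    by (induction rule: rtrancl_induct) (auto simp: assms(2) intro: son_edge_in_nodes[OF assms(1)])
qed

lemma self_in_desc: "t \<in> desc T t"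
  by (simp add: desc_def)

lemma finite_desc:
  assumes "rooted_tree T" "t \<in> nodes T"
  shows "finite (desc T t)"
  using desc_subset_nodes[OF assms] assms(1) by (auto simp: rooted_tree_def intro: finite_subset)

lemma desc_son_subset:
  assumes "(t, u) \<in> edges T"
  shows "desc T u \<subseteq> desc T t"
  using assms by (auto simp: desc_def intro: converse_rtrancl_into_rtrancl)

lemma self_notin_desc_son:
  assumes "rooted_tree T" "(t, u) \<in> edges T"
  shows "t \<notin> desc T u"
  using level_desc[OF assms(1)] level_son[OF assms] by fastforce

text \<open>Parents are unique, so two ancestors of one cluster lie on a single path to the root; on equal
  levels they coincide.\<close>

lemma desc_sons_disjoint:
  assumes tree: "rooted_tree T" and e: "(t, u) \<in> edges T" "(t, v) \<in> edges T" and "u \<noteq> v"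
  shows "desc T u \<inter> desc T v = {}"
proof (rule ccontr)
  assume "desc T u \<inter> desc T v \<noteq> {}"
  then obtain r where "(u, r) \<in> (edges T)\<^sup>*" "(v, r) \<in> (edges T)\<^sup>*"
    by (auto simp: desc_def)
  moreover have "single_valued ((edges T)\<inverse>)"
    using tree unfolding rooted_tree_def edges_def single_valued_def by blast
  ultimately have "(u, v) \<in> (edges T)\<^sup>* \<or> (v, u) \<in> (edges T)\<^sup>*"
    using single_valued_confluent[of "(edges T)\<inverse>" r u v] by (auto simp: rtrancl_converse)
  then have "v \<in> desc T u \<or> u \<in> desc T v"
    by (simp add: desc_def)
  then show False
    using level_desc[OF tree] level_son[OF tree e(1)] level_son[OF tree e(2)] \<open>u \<noteq> v\<close> by fastforce
qed

section \<open>Adjoint and stacked matrices\<close>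

lemma ctranspose_nth [simp]: "ctranspose A $ i $ j = cnj (A $ j $ i)"
  by (simp add: ctranspose_def map_matrix_def transpose_def)

lemma ctranspose_mult: "ctranspose (A ** B) = ctranspose B ** ctranspose A"
  by (simp add: vec_eq_iff matrix_matrix_mult_def mult.commute)

lemma ctranspose_ctranspose [simp]: "ctranspose (ctranspose A) = A"
  by (simp add: vec_eq_iff)

lemma matrix_sub_ldistrib: "A ** (B - C) = A ** B - A ** C"
  for A :: "'a::ring_1^'n::finite^'m"
  by (simp add: vec_eq_iff matrix_matrix_mult_def sum_subtractf right_diff_distrib)

text \<open>The inner product on complex vectors is the real part of the Hermitian one. It is
  weaker, but adjoints and the theorem of Pythagoras need only this real part.\<close>

lemma inner_matrix_vector_ctranspose:
  fixes A :: "complex^'n::finite^'m::finite"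
  shows "(A *v x) \<bullet> y = x \<bullet> (ctranspose A *v y)"
proof -
  have "(A *v x) \<bullet> y = (\<Sum>i\<in>UNIV. \<Sum>j\<in>UNIV. Re (A $ i $ j * x $ j * cnj (y $ i)))"
    by (simp add: inner_vec_def matrix_vector_mult_def inner_complex_def sum_distrib_right
        flip: sum.distrib)
  also have "\<dots> = (\<Sum>j\<in>UNIV. \<Sum>i\<in>UNIV. Re (A $ i $ j * x $ j * cnj (y $ i)))"
    by (rule sum.swap)
  also have "\<dots> = x \<bullet> (ctranspose A *v y)"
    by (simp add: inner_vec_def matrix_vector_mult_def inner_complex_def sum_distrib_left
        algebra_simps flip: sum.distrib)
  finally show ?thesis .
qed

definition hstack ::
    "complex^'a::finite^'m::finite \<Rightarrow> complex^'b::finite^'m \<Rightarrow> complex^('a + 'b)^'m" where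
  "hstack A B = (\<chi> i j. case j of Inl a \<Rightarrow> A $ i $ a | Inr b \<Rightarrow> B $ i $ b)"

lemma sum_UNIV_Plus:
  "(\<Sum>j\<in>UNIV. f j) = (\<Sum>a\<in>UNIV. f (Inl a)) + (\<Sum>b\<in>UNIV. f (Inr b))"
  for f :: "'a::finite + 'b::finite \<Rightarrow> 'c::comm_monoid_add"
  by (subst UNIV_sum, subst sum.union_disjoint) (auto simp: sum.reindex)

lemma hstack_mult_vstack: "hstack A B ** vstack C D = A ** C + B ** D"
  by (simp add: vec_eq_iff matrix_matrix_mult_def sum_UNIV_Plus hstack_def vstack_def)

lemma ctranspose_hstack_mult:
  "ctranspose (hstack A B) ** X = vstack (ctranspose A ** X) (ctranspose B ** X)"
  by (simp add: vec_eq_iff matrix_matrix_mult_def hstack_def vstack_def split: sum.split)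

lemma hstack_isometry:
  assumes "ctranspose A ** A = mat 1" "ctranspose B ** B = mat 1"
    and "ctranspose A ** B = 0" "ctranspose B ** A = 0"
  shows "ctranspose (hstack A B) ** hstack A B = mat 1"
proof -
  have "(ctranspose (hstack A B) ** hstack A B) $ i $ j = mat 1 $ i $ j" for i j
    using assms
    by (cases i; cases j) (simp_all add: vec_eq_iff matrix_matrix_mult_def hstack_def mat_def)
  then show ?thesis
    by (simp add: vec_eq_iff)
qed

section \<open>The two matrix norms\<close>

lemma mat_norm_nonneg: "0 \<le> mat_norm \<nu> A"
  by (cases \<nu>) (auto intro: onorm_pos_le)

lemma norm_matrix_sq_columns:
  fixes A :: "complex^'n::finite^'m::finite"
  shows "(norm A)\<^sup>2 = (\<Sum>j\<in>UNIV. (norm (A *v axis j 1))\<^sup>2)"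
proof -
  have col: "(A *v axis j 1) $ i = A $ i $ j" for i j
    by (simp add: matrix_vector_mult_def axis_def if_distrib cong: if_cong)
  have "(norm A)\<^sup>2 = (\<Sum>i\<in>UNIV. \<Sum>j\<in>UNIV. (norm (A $ i $ j))\<^sup>2)"
    by (simp add: norm_vec_def L2_set_def sum_nonneg)
  also have "\<dots> = (\<Sum>j\<in>UNIV. \<Sum>i\<in>UNIV. (norm (A $ i $ j))\<^sup>2)"
    by (rule sum.swap)
  also have "\<dots> = (\<Sum>j\<in>UNIV. (norm (A *v axis j 1))\<^sup>2)"
    by (simp add: norm_vec_def[of "A *v _"] L2_set_def sum_nonneg col)
  finally show ?thesis .
qed

text \<open>Both norms are monotone in the function \<open>x \<mapsto> \<parallel>M x\<parallel>\<close>: the Frobenius norm through its values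
  at the unit vectors, the spectral norm through its supremum over unit vectors \<open>x\<close>. Estimates that
  hold for every \<open>x\<close> thus carry over to both norms at once.\<close>

lemma mat_norm_sq_le_add:
  fixes M :: "complex^'n::finite^'m::finite"
    and A :: "complex^'n^'a::finite" and B :: "complex^'n^'b::finite"
  assumes le: "\<And>x. (norm (M *v x))\<^sup>2 \<le> (norm (A *v x))\<^sup>2 + (norm (B *v x))\<^sup>2"
  shows "(mat_norm \<nu> M)\<^sup>2 \<le> (mat_norm \<nu> A)\<^sup>2 + (mat_norm \<nu> B)\<^sup>2"
proof (cases \<nu>)
  case Frobenius
  then show ?thesis
    using sum_mono[OF le] by (simp add: norm_matrix_sq_columns sum.distrib)
next
  case Spectral
  let ?a = "onorm ((*v) A)" and ?b = "onorm ((*v) B)"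
  have "norm (M *v x) \<le> sqrt (?a\<^sup>2 + ?b\<^sup>2) * norm x" for x
  proof -
    have "(norm (M *v x))\<^sup>2 \<le> (?a * norm x)\<^sup>2 + (?b * norm x)\<^sup>2"
      by (rule order_trans[OF le]) (intro add_mono power_mono onorm norm_ge_zero; simp)
    also have "\<dots> = (sqrt (?a\<^sup>2 + ?b\<^sup>2) * norm x)\<^sup>2"
      by (simp add: power_mult_distrib distrib_right)
    finally show ?thesis
      by (rule power2_le_imp_le) simp
  qed
  then have "onorm ((*v) M) \<le> sqrt (?a\<^sup>2 + ?b\<^sup>2)"
    by (intro onorm_bound) auto
  then have "(onorm ((*v) M))\<^sup>2 \<le> (sqrt (?a\<^sup>2 + ?b\<^sup>2))\<^sup>2"
    by (intro power_mono) (auto intro: onorm_pos_le)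
  then show ?thesis using Spectral by simp
qed

lemma norm_isometry:
  fixes U :: "complex^'n::finite^'m::finite"
  assumes "ctranspose U ** U = mat 1"
  shows "norm (U *v x) = norm x"
  using assms
  by (simp add: norm_eq_sqrt_inner inner_matrix_vector_ctranspose matrix_vector_mul_assoc)

lemma mat_norm_sq_add_orthogonal:
  fixes A B :: "complex^'n::finite^'m::finite"
  assumes "ctranspose A ** B = 0"
  shows "(mat_norm \<nu> (A + B))\<^sup>2 \<le> (mat_norm \<nu> A)\<^sup>2 + (mat_norm \<nu> B)\<^sup>2"
proof (rule mat_norm_sq_le_add)
  fix x
  have "(A *v x) \<bullet> (B *v x) = 0"
    using assms by (simp add: inner_matrix_vector_ctranspose matrix_vector_mul_assoc)
  then show "(norm ((A + B) *v x))\<^sup>2 \<le> (norm (A *v x))\<^sup>2 + (norm (B *v x))\<^sup>2"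
    by (simp add: matrix_vector_mult_add_rdistrib power2_norm_eq_inner inner_add inner_commute)
qed

lemma mat_norm_isometry_mult_le:
  fixes U :: "complex^'n::finite^'m::finite" and X :: "complex^'p::finite^'n"
  assumes "ctranspose U ** U = mat 1"
  shows "(mat_norm \<nu> (U ** X))\<^sup>2 \<le> (mat_norm \<nu> X)\<^sup>2"
proof -
  have "(mat_norm \<nu> (U ** X))\<^sup>2 \<le> (mat_norm \<nu> X)\<^sup>2 + (mat_norm \<nu> (0 :: complex^'p^'n))\<^sup>2"
    by (rule mat_norm_sq_le_add)
      (simp add: norm_isometry[OF assms] flip: matrix_vector_mul_assoc)
  moreover have "(*v) (0 :: complex^'p^'n) = (\<lambda>x. 0)"
    by (simp add: fun_eq_iff)
  ultimately show ?thesis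
    by (cases \<nu>) (simp_all add: onorm_zero)
qed

text \<open>Restricting columns modifies the argument \<open>x\<close> and not the value \<open>A x\<close>, so there is no estimate for each
  \<open>x\<close> separately: the Frobenius norm loses entries, and the spectral norm is taken
  over fewer vectors.\<close>

lemma mat_norm_restrict_columns_le:
  fixes A :: "complex^'n::finite^'m::finite"
  shows "mat_norm \<nu> (restrict_mat UNIV C A) \<le> mat_norm \<nu> A"
proof (cases \<nu>)
  case Frobenius
  have "norm (restrict_mat UNIV C A) \<le> norm A"
    unfolding norm_vec_def
    by (intro L2_set_mono) (auto simp: restrict_mat_def)
  then show ?thesis using Frobenius by simp
next
  case Spectral
  have "norm (restrict_mat UNIV C A *v x) \<le> onorm ((*v) A) * norm x" for x
  proof -
    define y where "y = (\<chi> j. if j \<in> C then x $ j else 0)"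
    have "restrict_mat UNIV C A *v x = A *v y"
      by (auto simp: vec_eq_iff matrix_vector_mult_def restrict_mat_def y_def intro!: sum.cong)
    then have "norm (restrict_mat UNIV C A *v x) \<le> onorm ((*v) A) * norm y"
      by (simp add: onorm)
    also have "\<dots> \<le> onorm ((*v) A) * norm x"
      by (intro mult_left_mono onorm_pos_le norm_le_componentwise_cart)
        (auto simp: y_def)
    finally show ?thesis .
  qed
  then show ?thesis
    using Spectral by (simp add: onorm_bound onorm_pos_le)
qed

section \<open>Projection errors of a cluster and of its sons\<close>

definition projection_error ::
    "complex^'k::finite^'m::finite \<Rightarrow> complex^'n::finite^'m \<Rightarrow> complex^'n^'m" where
  "projection_error Q X = X - Q ** ctranspose Q ** X"

text \<open>The range of \<open>U ** R\<close> lies in the range of \<open>U\<close>, so the error splits into the part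
  orthogonal to the range of \<open>U\<close> and the error that \<open>R\<close> leaves in the coordinates
  given by \<open>U\<close>; the isometry \<open>U\<close> preserves the norm of the latter.\<close>

lemma projection_error_mult:
  assumes iso: "ctranspose U ** U = mat 1"
  shows "(mat_norm \<nu> (projection_error (U ** R) X))\<^sup>2
    \<le> (mat_norm \<nu> (projection_error U X))\<^sup>2
      + (mat_norm \<nu> (projection_error R (ctranspose U ** X)))\<^sup>2"
proof -
  let ?Z = "projection_error R (ctranspose U ** X)"
  have split: "projection_error (U ** R) X = projection_error U X + U ** ?Z"
    by (simp add: projection_error_def matrix_sub_ldistrib ctranspose_mult matrix_mul_assoc)
  have "ctranspose U ** projection_error U X = 0"
    using iso by (simp add: projection_error_def matrix_sub_ldistrib matrix_mul_assoc)
  then have "ctranspose (projection_error U X) ** U = ctranspose 0"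
    by (metis ctranspose_ctranspose ctranspose_mult)
  then have "ctranspose (projection_error U X) ** U ** ?Z = 0"
    by (simp add: vec_eq_iff matrix_matrix_mult_def)
  then have "ctranspose (projection_error U X) ** (U ** ?Z) = 0"
    by (simp add: matrix_mul_assoc)
  then show ?thesis
    unfolding split
    using mat_norm_sq_add_orthogonal mat_norm_isometry_mult_le[OF iso]
    by (meson add_left_mono order_trans)
qed

lemma ctranspose_mult_disjoint_rows:
  assumes "\<And>i. i \<notin> R \<Longrightarrow> A $ i = 0" "\<And>i. i \<notin> S \<Longrightarrow> B $ i = 0" "R \<inter> S = {}"
  shows "ctranspose A ** B = 0"
proof -
  have zero: "cnj (A $ l $ i) * B $ l $ j = 0" for i j l
    using assms(1)[of l] assms(2)[of l] assms(3) by (cases "l \<in> R") (auto simp: disjoint_iff)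
  show ?thesis
    by (simp add: vec_eq_iff matrix_matrix_mult_def zero)
qed

text \<open>Identifies \<open>U\<^sup>* P\<close>, formed with all rows of \<open>P\<close>, with the stacked products over the rows
  of one son each.\<close>

lemma ctranspose_mult_restrict_rows:
  assumes "\<And>i. i \<notin> R \<Longrightarrow> A $ i = 0" "R \<subseteq> S"
  shows "ctranspose A ** restrict_mat S C G = ctranspose A ** restrict_mat R C G"
proof -
  have eq: "cnj (A $ l $ i) * restrict_mat S C G $ l $ j = cnj (A $ l $ i) * restrict_mat R C G $ l $ j"
    for i j l
    using assms(1)[of l] assms(2) by (cases "l \<in> R") (auto simp: restrict_mat_def)
  show ?thesis
    by (simp add: vec_eq_iff matrix_matrix_mult_def eq)
qed

lemma projection_error_rows:
  assumes "\<And>i. i \<notin> R \<Longrightarrow> Q $ i = 0" "i \<notin> R"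
  shows "projection_error Q (restrict_mat R C G) $ i = 0"
  using assms
  by (simp add: vec_eq_iff projection_error_def restrict_mat_def matrix_matrix_mult_def)

text \<open>The projection multiplies from the left and treats every column separately.\<close>

lemma projection_error_restrict_columns:
  assumes "C \<subseteq> C'"
  shows "projection_error Q (restrict_mat R C G)
    = restrict_mat UNIV C (projection_error Q (restrict_mat R C' G))"
  using assms
  by (auto simp: vec_eq_iff projection_error_def restrict_mat_def matrix_matrix_mult_def
      intro!: sum.cong)

text \<open>Since \<open>Q1\<close> and \<open>Q2\<close> have disjoint row supports, projecting with \<open>hstack Q1 Q2\<close> acts on
  the two row blocks separately, and the two errors are orthogonal.\<close>

lemma projection_error_hstack:
  assumes Q1: "\<And>i. i \<notin> R1 \<Longrightarrow> Q1 $ i = 0" and Q2: "\<And>i. i \<notin> R2 \<Longrightarrow> Q2 $ i = 0"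
    and disj: "R1 \<inter> R2 = {}"
  shows "(mat_norm \<nu> (projection_error (hstack Q1 Q2) (restrict_mat (R1 \<union> R2) C G)))\<^sup>2
    \<le> (mat_norm \<nu> (projection_error Q1 (restrict_mat R1 C G)))\<^sup>2
      + (mat_norm \<nu> (projection_error Q2 (restrict_mat R2 C G)))\<^sup>2"
proof -
  have rows: "restrict_mat (R1 \<union> R2) C G = restrict_mat R1 C G + restrict_mat R2 C G"
    using disj by (auto simp: vec_eq_iff restrict_mat_def)
  have "hstack Q1 Q2 ** ctranspose (hstack Q1 Q2) ** restrict_mat (R1 \<union> R2) C G
      = Q1 ** (ctranspose Q1 ** restrict_mat R1 C G) + Q2 ** (ctranspose Q2 ** restrict_mat R2 C G)"
    using ctranspose_mult_restrict_rows[of R1 Q1 "R1 \<union> R2" C G, OF Q1]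
      ctranspose_mult_restrict_rows[of R2 Q2 "R1 \<union> R2" C G, OF Q2]
    by (simp add: ctranspose_hstack_mult hstack_mult_vstack flip: matrix_mul_assoc)
  then have "projection_error (hstack Q1 Q2) (restrict_mat (R1 \<union> R2) C G)
      = projection_error Q1 (restrict_mat R1 C G) + projection_error Q2 (restrict_mat R2 C G)"
    by (simp add: projection_error_def matrix_mul_assoc) (simp add: rows)
  moreover have "ctranspose (projection_error Q1 (restrict_mat R1 C G))
      ** projection_error Q2 (restrict_mat R2 C G) = 0"
    using projection_error_rows[OF Q1] projection_error_rows[OF Q2] disj
    by (rule ctranspose_mult_disjoint_rows)
  ultimately show ?thesis
    using mat_norm_sq_add_orthogonal by metis
qed

section \<open>Far fields of sons\<close>

text \<open>Passing to a son appends one son mapping to the chain of directions, so every block that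
  contributes to \<open>(t, c)\<close> contributes to \<open>(u, sd c)\<close> as well.\<close>

lemma far_indices_son:
  assumes tree: "rooted_tree T" and e: "(t, u) \<in> edges T"
  shows "far_indices T sd Ladm bdir t c \<subseteq> far_indices T sd Ladm bdir u (sd (level T t) c)"
proof -
  have "s \<in> far_clusters T sd Ladm bdir u (sd (level T t) c)"
    if s: "s \<in> far_clusters T sd Ladm bdir t c" for s
  proof -
    obtain tp where tp: "t \<in> desc T tp" "(tp, s) \<in> Ladm"
      and c: "c = sd_iter sd (level T tp) (level T t - level T tp) (bdir (tp, s))"
      using s unfolding far_clusters_def by blast
    have "level T tp \<le> level T t"
      using level_desc[OF tree tp(1)] by auto
    then have "sd (level T t) c
        = sd_iter sd (level T tp) (level T u - level T tp) (bdir (tp, s))"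
      by (simp add: c level_son[OF tree e] Suc_diff_le)
    moreover have "u \<in> desc T tp"
      using tp(1) e by (auto simp: desc_def)
    ultimately show ?thesis
      using tp(2) by (auto simp: far_clusters_def)
  qed
  then show ?thesis
    by (auto simp: far_indices_def)
qed

theorem theorem15:
  fixes T :: "('v, 'i::finite) cluster_tree"
    and son1 son2 :: "'v \<Rightarrow> 'v"
    and B :: "('v \<times> 'v) tree"
    and Ladm :: "('v \<times> 'v) set"
    and D :: "nat \<Rightarrow> direction set"
    and sd :: "nat \<Rightarrow> direction \<Rightarrow> direction"
    and bdir :: "'v \<times> 'v \<Rightarrow> direction"
    and G :: "complex^'i^'i"
    and Q :: "'v \<Rightarrow> direction \<Rightarrow> complex^'k::finite^'i"
    and E :: "'v \<Rightarrow> direction \<Rightarrow> complex^'k^'k"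
    and \<epsilon> :: "'v \<Rightarrow> real"
    and \<nu> :: norm_kind
  assumes "is_cluster_tree T"
    and "binary_sons T son1 son2"
    and "is_block_tree T B"
    and "Ladm \<subseteq> leaves B"
    and "directions T D"
    and "son_directions T D sd"
    and "\<And>t s. (t, s) \<in> Ladm \<Longrightarrow> bdir (t, s) \<in> D (level T t)"
    and "directional_cluster_basis T D sd Q E"
    and "orthogonal_basis T D Q"
    and "\<And>t. t \<in> nodes T \<Longrightarrow> \<epsilon> t > 0"
    and "\<And>t c. t \<in> leaves T \<Longrightarrow> c \<in> D (level T t) \<Longrightarrow>
           mat_norm \<nu> (G_far T sd Ladm bdir G t c
             - Q t c ** ctranspose (Q t c) ** G_far T sd Ladm bdir G t c) \<le> \<epsilon> t"
    and "\<And>t c. t \<in> nodes T - leaves T \<Longrightarrow> c \<in> D (level T t) \<Longrightarrow>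
           mat_norm \<nu> (G_hat T son1 son2 sd Ladm bdir Q G t c
             - Q_hat son1 son2 E t c ** ctranspose (Q_hat son1 son2 E t c)
                 ** G_hat T son1 son2 sd Ladm bdir Q G t c) \<le> \<epsilon> t"
  shows "\<forall>t\<in>nodes T. \<forall>c\<in>D (level T t).
           (mat_norm \<nu> (G_far T sd Ladm bdir G t c
             - Q t c ** ctranspose (Q t c) ** G_far T sd Ladm bdir G t c))\<^sup>2
           \<le> (\<Sum>r\<in>desc T t. (\<epsilon> r)\<^sup>2)"
proof (intro ballI)
  fix t c
  assume "t \<in> nodes T" "c \<in> D (level T t)"
  have tree: "rooted_tree T"
    using assms(1) by (simp add: is_cluster_tree_def)
  let ?err = "\<lambda>t c. projection_error (Q t c) (G_far T sd Ladm bdir G t c)"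
  have "(mat_norm \<nu> (?err t c))\<^sup>2 \<le> (\<Sum>r\<in>desc T t. (\<epsilon> r)\<^sup>2)"
    using \<open>t \<in> nodes T\<close> \<open>c \<in> D (level T t)\<close>
  proof (induction "card (desc T t)" arbitrary: t c rule: less_induct)
    case less
    note t = \<open>t \<in> nodes T\<close> and c = \<open>c \<in> D (level T t)\<close>
    show ?case
    proof (cases "t \<in> leaves T")
      case True
      then have "mat_norm \<nu> (?err t c) \<le> \<epsilon> t"
        using assms(11) c by (simp add: projection_error_def)
      then have "(mat_norm \<nu> (?err t c))\<^sup>2 \<le> (\<epsilon> t)\<^sup>2"
        by (intro power_mono mat_norm_nonneg)
      also have "\<dots> \<le> (\<Sum>r\<in>desc T t. (\<epsilon> r)\<^sup>2)"
        by (intro member_le_sum) (auto simp: self_in_desc finite_desc[OF tree t])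
      finally show ?thesis .
    next
      case False
      define t1 t2 c' F where "t1 = son1 t" and "t2 = son2 t" and "c' = sd (level T t) c"
        and "F = far_indices T sd Ladm bdir t c"
      have inner: "t \<in> nodes T - leaves T" using t False by simp
      have sons: "sons T t = {t1, t2}" and "t1 \<noteq> t2"
        using assms(2) inner by (auto simp: binary_sons_def t1_def t2_def)
      have e: "(t, t1) \<in> edges T" "(t, t2) \<in> edges T"
        using t sons by (auto simp: edges_def)
      note son_nodes = son_edge_in_nodes[OF tree e(1)] son_edge_in_nodes[OF tree e(2)]
      note levels = level_son[OF tree e(1)] level_son[OF tree e(2)]
      have label: "label T t = label T t1 \<union> label T t2"
        using assms(1) inner sons by (auto simp: is_cluster_tree_def)
      have disj: "label T t1 \<inter> label T t2 = {}"
        using assms(1) t sons \<open>t1 \<noteq> t2\<close> by (auto simp: is_cluster_tree_def disjoint_family_on_def)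
      have "level T t \<in> levels T" "Suc (level T t) \<in> levels T"
        using t son_nodes levels by (metis imageI levels_def)+
      then have c': "c' \<in> D (level T t1)" "c' \<in> D (level T t2)"
        using assms(6) c levels by (auto simp: son_directions_def c'_def)

      have supp: "Q t1 c' $ i = 0" if "i \<notin> label T t1" for i
        using assms(8) son_nodes c' that by (auto simp: directional_cluster_basis_def)
      have supp': "Q t2 c' $ i = 0" if "i \<notin> label T t2" for i
        using assms(8) son_nodes c' that by (auto simp: directional_cluster_basis_def)
      have supp_t: "Q t c $ i = 0" if "i \<notin> label T t1 \<union> label T t2" for i
        using assms(8) t c that label by (auto simp: directional_cluster_basis_def)
      define U where "U = hstack (Q t1 c') (Q t2 c')"
      have "ctranspose (Q t1 c') ** Q t2 c' = 0"
        using supp supp' disj by (rule ctranspose_mult_disjoint_rows)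
      moreover have "ctranspose (Q t2 c') ** Q t1 c' = 0"
        using supp' supp disj by (intro ctranspose_mult_disjoint_rows) blast+
      ultimately have iso: "ctranspose U ** U = mat 1"
        unfolding U_def
        using assms(9) son_nodes c'
        by (intro hstack_isometry) (auto simp: orthogonal_basis_def)

      have "Q t c = restrict_mat (label T t1) UNIV (Q t c) + restrict_mat (label T t2) UNIV (Q t c)"
        using supp_t disj by (auto simp: vec_eq_iff restrict_mat_def)
      also have "\<dots> = Q t1 c' ** E t1 c + Q t2 c' ** E t2 c"
        using assms(8) t c sons by (simp add: directional_cluster_basis_def c'_def)
      finally have Q: "Q t c = U ** Q_hat son1 son2 E t c"
        by (simp add: U_def Q_hat_def hstack_mult_vstack t1_def t2_def)
      have P: "G_far T sd Ladm bdir G t c = restrict_mat (label T t1 \<union> label T t2) F G"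
        by (simp add: G_far_def label F_def)
      have G: "ctranspose U ** G_far T sd Ladm bdir G t c = G_hat T son1 son2 sd Ladm bdir Q G t c"
        using ctranspose_mult_restrict_rows[of "label T t1" "Q t1 c'" "label T t1 \<union> label T t2" F G, OF supp]
          ctranspose_mult_restrict_rows[of "label T t2" "Q t2 c'" "label T t1 \<union> label T t2" F G, OF supp']
        unfolding P U_def ctranspose_hstack_mult G_hat_def Let_def
        by (simp add: t1_def t2_def c'_def F_def)

      \<comment> \<open>The hypothesis at \<open>t\<close> bounds the error in the coordinates given by \<open>U\<close>; the errors of the
        sons are bounded on their own, larger far fields.\<close>
      have local_error: "(mat_norm \<nu> (projection_error (Q_hat son1 son2 E t c)
          (G_hat T son1 son2 sd Ladm bdir Q G t c)))\<^sup>2 \<le> (\<epsilon> t)\<^sup>2"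
        using assms(12)[OF inner c]
        by (intro power_mono mat_norm_nonneg) (simp add: projection_error_def)
      have son: "(mat_norm \<nu> (projection_error (Q u c') (restrict_mat (label T u) F G)))\<^sup>2
          \<le> (\<Sum>r\<in>desc T u. (\<epsilon> r)\<^sup>2)"
        if eu: "(t, u) \<in> edges T" and cu: "c' \<in> D (level T u)" for u
      proof -
        have "projection_error (Q u c') (restrict_mat (label T u) F G)
            = restrict_mat UNIV F (?err u c')"
          unfolding G_far_def
          by (rule projection_error_restrict_columns)
            (simp add: F_def c'_def far_indices_son[OF tree eu])
        then have "(mat_norm \<nu> (projection_error (Q u c') (restrict_mat (label T u) F G)))\<^sup>2
            \<le> (mat_norm \<nu> (?err u c'))\<^sup>2"
          by (simp add: mat_norm_restrict_columns_le mat_norm_nonneg power_mono)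
        also have "desc T u \<subset> desc T t"
          using desc_son_subset[OF eu] self_notin_desc_son[OF tree eu] self_in_desc[of t T] by auto
        then have "card (desc T u) < card (desc T t)"
          using finite_desc[OF tree t] by (rule psubset_card_mono[rotated])
        then have "(mat_norm \<nu> (?err u c'))\<^sup>2 \<le> (\<Sum>r\<in>desc T u. (\<epsilon> r)\<^sup>2)"
          using son_edge_in_nodes[OF tree eu] cu by (rule less.hyps)
        finally show ?thesis .
      qed

      have "(mat_norm \<nu> (?err t c))\<^sup>2
          \<le> (\<epsilon> t)\<^sup>2 + ((\<Sum>r\<in>desc T t1. (\<epsilon> r)\<^sup>2) + (\<Sum>r\<in>desc T t2. (\<epsilon> r)\<^sup>2))"
        using projection_error_mult[OF iso, of \<nu> "Q_hat son1 son2 E t c" "G_far T sd Ladm bdir G t c"]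
          projection_error_hstack[OF supp supp' disj, of \<nu> F G]
          local_error son[OF e(1) c'(1)] son[OF e(2) c'(2)]
        unfolding Q[symmetric] G unfolding P U_def by linarith
      also have "\<dots> = (\<Sum>r\<in>insert t (desc T t1 \<union> desc T t2). (\<epsilon> r)\<^sup>2)"
        using self_notin_desc_son[OF tree e(1)] self_notin_desc_son[OF tree e(2)]
          desc_sons_disjoint[OF tree e \<open>t1 \<noteq> t2\<close>]
          finite_desc[OF tree son_nodes(1)] finite_desc[OF tree son_nodes(2)]
        by (simp add: sum.union_disjoint)
      also have "\<dots> \<le> (\<Sum>r\<in>desc T t. (\<epsilon> r)\<^sup>2)"
        using desc_son_subset[OF e(1)] desc_son_subset[OF e(2)] finite_desc[OF tree t]
        by (intro sum_mono2) (auto simp: self_in_desc)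
      finally show ?thesis .
    qed
  qed
  then show "(mat_norm \<nu> (G_far T sd Ladm bdir G t c
      - Q t c ** ctranspose (Q t c) ** G_far T sd Ladm bdir G t c))\<^sup>2
      \<le> (\<Sum>r\<in>desc T t. (\<epsilon> r)\<^sup>2)"
    by (simp add: projection_error_def)
qed

end
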